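(* Let $\mathsf C=(C_0,C_1,d_0,d_1,i,m)$ and $\mathsf C'=(C'_0,C'_1,d'_0,d'_1,i',m')$ be categorical groups and let $F=(F_0,F_1):\mathsf C\to\mathsf C'$ be a morphism of categorical groups. Put $\varphi_0=F_0:C_0\to C_0'$ and $\varphi_1=F_1|_{\mathbf{Star}_{\mathsf C}0}:\mathbf{Star}_{\mathsf C}0\to\mathbf{Star}_{\mathsf C'}0$. Then $(\varphi_0,\varphi_1)$ is a morphism of c-crossed modules from $\mathbf{Star}_{\mathsf C}0\xrightarrow{d_1|}C_0$ to $\mathbf{Star}_{\mathsf C'}0\xrightarrow{d'_1|}C'_0$.
   Context: **Categorical groups.** A categorical group $\mathsf C=(C_0,C_1,d_0,d_1,i,m)$ (objects $C_0$, arrows $C_1$, source $d_0$, target $d_1$, identities $i$, composition $m$) is a groupoid with a bifunctor $+$, an object $0$ and natural isomorphisms $\alpha_{x,y,z}:(x+y)+z\to x+(y+z)$, $\lambda_x:0+x\to x$, $\rho_x:x+0\to x$ satisfying the pentagon and triangle axioms and $\lambda_0=\rho_0$, together with, for every object $x$, an object $-x$ and natural isomorphisms $\epsilon_x:-x+x\to 0$, $\delta_x:x+(-x)\to 0$ with $(1_x+\epsilon_x)\alpha_{x,-x,x}(\delta_x^{-1}+1_x)=\rho_x^{-1}\lambda_x$ and $(\epsilon_x+1_{-x})\alpha^{-1}_{-x,x,-x}(1_{-x}+\delta_x^{-1})=\lambda_{-x}^{-1}\rho_{-x}$. Every arrow $f:x\to x'$ has an arrow $-f:-x\to-x'$ with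 natural isomorphisms $-f+f\approx1_0\approx f+(-f)$; $a-b$ means $a+(-b)$. The isomorphisms $\alpha,\lambda,\rho,\epsilon,\delta$, identities, their compositions and sums (and inverses) are called special; all diagrams of special isomorphisms commute (coherence). Two arrows $f,g$ are isomorphic if there are isomorphisms $\theta_j:d_j(f)\to d_j(g)$, $j=0,1$, with $\theta_1f=g\theta_0$. A morphism of categorical groups is a functor $T$ with $T(x+y)=Tx+'Ty$, $T(f+g)=Tf+'Tg$, $T0=0'$, $T\alpha_{x,y,z}=\alpha'_{Tx,Ty,Tz}$, $T\lambda_x=\lambda'_{Tx}$, $T\rho_x=\rho'_{Tx}$; it is asserted that this implies $T(-x)=-T(x)$ and $T(-f)=-T(f)$. **c-groups and c-crossed modules.** A c-group is a set $G$ with an equivalence relation $\sim$ (congruence) and an operation $+$ compatible with $\sim$ such that $a+(b+c)\sim(a+b)+c$, with a given element $0$, $a+0\sim a\sim0+a$, and given elements $-a$, $a+(-a)\sim0\sim-a+a$. Morphisms of c-groups preserve $\sim$ and satisfy $f(a+b)=f(a)+f(b)$. An action of $H$ on $G$ is a map $(b,a)\mapsto b\cdot a$ respecting $\sim$ in both variables with $b\cdot(a+a_1)\sim b\cdot a+b\cdot a_1$, $(b+b_1)\cdot a\sim b\cdot(b_1\cdot a)$, $0\cdot a\sim a$. A c-crossed module is a c-group morphism $\partial:M\to N$ with an action of $N$ on $M$ such that $\partial(b\cdot a)=b+(\partial(a)-b)$ and $\partial(a)\cdot a_1\sim a+(a_1-a)$. A morphism from $\partial:M\to N$ to $\partial':M'\to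 N'$ is a pair $(\varphi_0,\varphi_1)$ of c-group morphisms $\varphi_0:N\to N'$, $\varphi_1:M\to M'$ with $\varphi_0\partial=\partial'\varphi_1$ and $\varphi_1(b\cdot a)=\varphi_0(b)\cdot\varphi_1(a)$. **The c-crossed module of a categorical group.** $C_0$ is a c-group with congruence "isomorphic in $\mathsf C$". $\mathbf{Star}_{\mathsf C}0=\{f\in C_1: d_0(f)=0\}$ is a c-group with sum $(f+f')\gamma$, where $f+f':0+0\to d_1(f)+d_1(f')$ is the sum in $C_1$ and $\gamma:0\to0+0$ is the unique special isomorphism, and with congruence "isomorphic in $C_1$". $C_0$ acts on it by $r\cdot c=(i(r)+(c-i(r)))\gamma$ with $\gamma:0\to r+(0-r)$ the special isomorphism. With these structures $d_1|:\mathbf{Star}_{\mathsf C}0\to C_0$ is a c-crossed module.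
   Formalization: It is additionally assumed that F carries δ_x to δ'_{F(x)} for every object x, without which the claim fails; T(-x)=-T(x) and T(-f)=-T(f), asserted to be consequences, are part of the definition of morphism. *)

theory Defs
  imports "HOL-Library.FuncSet"
begin

section \<open>Categorical groups\<close>

record ('o, 'a) catgrp =
  Obj :: "'o set"
  Arr :: "'a set"
  src :: "'a \<Rightarrow> 'o"
  tgt :: "'a \<Rightarrow> 'o"
  idt :: "'o \<Rightarrow> 'a" ("\<one>\<index>")
  cmp :: "'a \<Rightarrow> 'a \<Rightarrow> 'a" (infixr "\<cdot>\<index>" 70) \<comment> \<open>\<open>g \<cdot> f\<close> is \<open>g\<close> after \<open>f\<close>\<close>
  osum :: "'o \<Rightarrow> 'o \<Rightarrow> 'o" (infixl "\<oplus>\<index>" 65)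
  asum :: "'a \<Rightarrow> 'a \<Rightarrow> 'a" (infixl "\<boxplus>\<index>" 65)
  null :: "'o" ("\<zero>\<index>")
  oneg :: "'o \<Rightarrow> 'o" ("\<ominus>\<index> _" [81] 80)
  aneg :: "'a \<Rightarrow> 'a" ("\<boxminus>\<index> _" [81] 80)
  alpha :: "'o \<Rightarrow> 'o \<Rightarrow> 'o \<Rightarrow> 'a" ("\<alpha>\<index>")
  lam :: "'o \<Rightarrow> 'a" ("\<Lambda>\<index>")
  rho :: "'o \<Rightarrow> 'a" ("\<rho>\<index>")
  eps :: "'o \<Rightarrow> 'a" ("\<epsilon>\<index>")
  del :: "'o \<Rightarrow> 'a" ("\<delta>\<index>")

definition hom :: "('o, 'a) catgrp \<Rightarrow> 'o \<Rightarrow> 'o \<Rightarrow> 'a set"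
  where "hom C x y = {f \<in> Arr C. src C f = x \<and> tgt C f = y}"

definition inverse_arrows :: "('o, 'a) catgrp \<Rightarrow> 'a \<Rightarrow> 'a \<Rightarrow> bool"
  where "inverse_arrows C f g \<longleftrightarrow>
    f \<in> Arr C \<and> g \<in> hom C (tgt C f) (src C f) \<and>
    cmp C g f = idt C (src C f) \<and> cmp C f g = idt C (tgt C f)"

definition is_iso :: "('o, 'a) catgrp \<Rightarrow> 'a \<Rightarrow> bool"
  where "is_iso C f \<longleftrightarrow> (\<exists>g. inverse_arrows C f g)"

definition arr_inv :: "('o, 'a) catgrp \<Rightarrow> 'a \<Rightarrow> 'a" ("inv\<index> _" [81] 80)
  where "arr_inv C f = (THE g. inverse_arrows C f g)"

locale small_groupoid =
  fixes C :: "('o, 'a) catgrp" (structure)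
  assumes src_in: "f \<in> Arr C \<Longrightarrow> src C f \<in> Obj C"
    and tgt_in: "f \<in> Arr C \<Longrightarrow> tgt C f \<in> Obj C"
    and idt_hom: "x \<in> Obj C \<Longrightarrow> \<one> x \<in> hom C x x"
    and cmp_hom: "\<lbrakk>f \<in> hom C x y; g \<in> hom C y z\<rbrakk> \<Longrightarrow> g \<cdot> f \<in> hom C x z"
    and idt_left: "f \<in> hom C x y \<Longrightarrow> \<one> y \<cdot> f = f"
    and idt_right: "f \<in> hom C x y \<Longrightarrow> f \<cdot> \<one> x = f"
    and cmp_assoc:
      "\<lbrakk>f \<in> hom C x y; g \<in> hom C y z; h \<in> hom C z w\<rbrakk> \<Longrightarrow> (h \<cdot> g) \<cdot> f = h \<cdot> (g \<cdot> f)"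
    and arrows_iso: "f \<in> Arr C \<Longrightarrow> is_iso C f"

locale categorical_group = small_groupoid C for C :: "('o, 'a) catgrp" (structure) +
  assumes osum_in: "\<lbrakk>x \<in> Obj C; y \<in> Obj C\<rbrakk> \<Longrightarrow> x \<oplus> y \<in> Obj C"
    and asum_hom: "\<lbrakk>f \<in> hom C x x'; g \<in> hom C y y'\<rbrakk> \<Longrightarrow> f \<boxplus> g \<in> hom C (x \<oplus> y) (x' \<oplus> y')"
    and asum_idt: "\<lbrakk>x \<in> Obj C; y \<in> Obj C\<rbrakk> \<Longrightarrow> \<one> x \<boxplus> \<one> y = \<one> (x \<oplus> y)"
    and asum_cmp:
      "\<lbrakk>f \<in> hom C x x'; f' \<in> hom C x' x''; g \<in> hom C y y'; g' \<in> hom C y' y''\<rbrakk>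
        \<Longrightarrow> (f' \<cdot> f) \<boxplus> (g' \<cdot> g) = (f' \<boxplus> g') \<cdot> (f \<boxplus> g)"
    and null_in: "\<zero> \<in> Obj C"
    and alpha_hom: "\<lbrakk>x \<in> Obj C; y \<in> Obj C; z \<in> Obj C\<rbrakk>
        \<Longrightarrow> \<alpha> x y z \<in> hom C ((x \<oplus> y) \<oplus> z) (x \<oplus> (y \<oplus> z))"
    and alpha_natural: "\<lbrakk>f \<in> hom C x x'; g \<in> hom C y y'; h \<in> hom C z z'\<rbrakk>
        \<Longrightarrow> \<alpha> x' y' z' \<cdot> ((f \<boxplus> g) \<boxplus> h) = (f \<boxplus> (g \<boxplus> h)) \<cdot> \<alpha> x y z"
    and lam_hom: "x \<in> Obj C \<Longrightarrow> \<Lambda> x \<in> hom C (\<zero> \<oplus> x) x"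
    and lam_natural: "f \<in> hom C x x' \<Longrightarrow> \<Lambda> x' \<cdot> (\<one> \<zero> \<boxplus> f) = f \<cdot> \<Lambda> x"
    and rho_hom: "x \<in> Obj C \<Longrightarrow> \<rho> x \<in> hom C (x \<oplus> \<zero>) x"
    and rho_natural: "f \<in> hom C x x' \<Longrightarrow> \<rho> x' \<cdot> (f \<boxplus> \<one> \<zero>) = f \<cdot> \<rho> x"
    and pentagon: "\<lbrakk>x \<in> Obj C; y \<in> Obj C; z \<in> Obj C; t \<in> Obj C\<rbrakk>
        \<Longrightarrow> \<alpha> x y (z \<oplus> t) \<cdot> \<alpha> (x \<oplus> y) z t
          = (\<one> x \<boxplus> \<alpha> y z t) \<cdot> (\<alpha> x (y \<oplus> z) t \<cdot> (\<alpha> x y z \<boxplus> \<one> t))"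
    and triangle: "\<lbrakk>x \<in> Obj C; y \<in> Obj C\<rbrakk>
        \<Longrightarrow> (\<one> x \<boxplus> \<Lambda> y) \<cdot> \<alpha> x \<zero> y = \<rho> x \<boxplus> \<one> y"
    and lam_rho_null: "\<Lambda> \<zero> = \<rho> \<zero>"
    and oneg_in: "x \<in> Obj C \<Longrightarrow> \<ominus> x \<in> Obj C"
    and aneg_hom: "f \<in> hom C x x' \<Longrightarrow> \<boxminus> f \<in> hom C (\<ominus> x) (\<ominus> x')"
    and eps_hom: "x \<in> Obj C \<Longrightarrow> \<epsilon> x \<in> hom C (\<ominus> x \<oplus> x) \<zero>"
    and eps_natural: "f \<in> hom C x x' \<Longrightarrow> \<epsilon> x' \<cdot> (\<boxminus> f \<boxplus> f) = \<one> \<zero> \<cdot> \<epsilon> x"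
    and del_hom: "x \<in> Obj C \<Longrightarrow> \<delta> x \<in> hom C (x \<oplus> \<ominus> x) \<zero>"
    and del_natural: "f \<in> hom C x x' \<Longrightarrow> \<delta> x' \<cdot> (f \<boxplus> \<boxminus> f) = \<one> \<zero> \<cdot> \<delta> x"
    and inverse_triangle1: "x \<in> Obj C \<Longrightarrow>
          (\<one> x \<boxplus> \<epsilon> x) \<cdot> (\<alpha> x (\<ominus> x) x \<cdot> (inv (\<delta> x) \<boxplus> \<one> x)) = inv (\<rho> x) \<cdot> \<Lambda> x"
    and inverse_triangle2: "x \<in> Obj C \<Longrightarrow>
          (\<epsilon> x \<boxplus> \<one> (\<ominus> x)) \<cdot> (inv (\<alpha> (\<ominus> x) x (\<ominus> x)) \<cdot> (\<one> (\<ominus> x) \<boxplus> inv (\<delta> x)))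
            = inv (\<Lambda> (\<ominus> x)) \<cdot> \<rho> (\<ominus> x)"

definition obj_iso :: "('o, 'a) catgrp \<Rightarrow> 'o \<Rightarrow> 'o \<Rightarrow> bool"
  where "obj_iso C x y \<longleftrightarrow> (\<exists>\<theta> \<in> hom C x y. is_iso C \<theta>)"

definition arr_iso :: "('o, 'a) catgrp \<Rightarrow> 'a \<Rightarrow> 'a \<Rightarrow> bool"
  where "arr_iso C f g \<longleftrightarrow>
    (\<exists>\<theta>\<^sub>0 \<in> hom C (src C f) (src C g). \<exists>\<theta>\<^sub>1 \<in> hom C (tgt C f) (tgt C g).
       is_iso C \<theta>\<^sub>0 \<and> is_iso C \<theta>\<^sub>1 \<and> cmp C \<theta>\<^sub>1 f = cmp C g \<theta>\<^sub>0)"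

text \<open>The equations for \<open>oneg\<close> and \<open>aneg\<close> are part of the notion: preservation of the other
  operations does not entail them, because negatives are chosen, not determined. Preservation
  of \<open>eps\<close> and \<open>del\<close> is not required, and does not follow.\<close>

locale categorical_group_morphism =
  C: categorical_group C + C': categorical_group C'
  for C :: "('o, 'a) catgrp" and C' :: "('p, 'b) catgrp" +
  fixes T\<^sub>0 :: "'o \<Rightarrow> 'p" and T\<^sub>1 :: "'a \<Rightarrow> 'b"
  assumes obj_map: "x \<in> Obj C \<Longrightarrow> T\<^sub>0 x \<in> Obj C'"
    and hom_map: "f \<in> hom C x y \<Longrightarrow> T\<^sub>1 f \<in> hom C' (T\<^sub>0 x) (T\<^sub>0 y)"
    and map_idt: "x \<in> Obj C \<Longrightarrow> T\<^sub>1 (idt C x) = idt C' (T\<^sub>0 x)"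
    and map_cmp: "\<lbrakk>f \<in> hom C x y; g \<in> hom C y z\<rbrakk> \<Longrightarrow> T\<^sub>1 (cmp C g f) = cmp C' (T\<^sub>1 g) (T\<^sub>1 f)"
    and map_osum: "\<lbrakk>x \<in> Obj C; y \<in> Obj C\<rbrakk> \<Longrightarrow> T\<^sub>0 (osum C x y) = osum C' (T\<^sub>0 x) (T\<^sub>0 y)"
    and map_asum: "\<lbrakk>f \<in> Arr C; g \<in> Arr C\<rbrakk> \<Longrightarrow> T\<^sub>1 (asum C f g) = asum C' (T\<^sub>1 f) (T\<^sub>1 g)"
    and map_null: "T\<^sub>0 (null C) = null C'"
    and map_alpha: "\<lbrakk>x \<in> Obj C; y \<in> Obj C; z \<in> Obj C\<rbrakk>
        \<Longrightarrow> T\<^sub>1 (alpha C x y z) = alpha C' (T\<^sub>0 x) (T\<^sub>0 y) (T\<^sub>0 z)"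
    and map_lam: "x \<in> Obj C \<Longrightarrow> T\<^sub>1 (lam C x) = lam C' (T\<^sub>0 x)"
    and map_rho: "x \<in> Obj C \<Longrightarrow> T\<^sub>1 (rho C x) = rho C' (T\<^sub>0 x)"
    and map_oneg: "x \<in> Obj C \<Longrightarrow> T\<^sub>0 (oneg C x) = oneg C' (T\<^sub>0 x)"
    and map_aneg: "f \<in> Arr C \<Longrightarrow> T\<^sub>1 (aneg C f) = aneg C' (T\<^sub>1 f)"


section \<open>Special isomorphisms\<close>

text \<open>A special isomorphism is a formal composite between formal expressions in objects;
  coherence makes it unique for given formal source and target. It would not be unique for
  given objects of \<open>C\<close>, since different expressions may accidentally denote the same object.\<close>

datatype (gobjs: 'o) gexp =
    Gen 'o
  | Zero
  | Plus "'o gexp" "'o gexp"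
  | Minus "'o gexp"

primrec val :: "('o, 'a) catgrp \<Rightarrow> 'o gexp \<Rightarrow> 'o"
  where
    "val C (Gen x) = x"
  | "val C Zero = null C"
  | "val C (Plus d e) = osum C (val C d) (val C e)"
  | "val C (Minus e) = oneg C (val C e)"

inductive special :: "('o, 'a) catgrp \<Rightarrow> 'o gexp \<Rightarrow> 'o gexp \<Rightarrow> 'a \<Rightarrow> bool"
  for C :: "('o, 'a) catgrp"
  where
    special_idt: "gobjs e \<subseteq> Obj C \<Longrightarrow> special C e e (idt C (val C e))"
  | special_alpha: "\<lbrakk>gobjs d \<subseteq> Obj C; gobjs e \<subseteq> Obj C; gobjs e' \<subseteq> Obj C\<rbrakk>
      \<Longrightarrow> special C (Plus (Plus d e) e') (Plus d (Plus e e')) (alpha C (val C d) (val C e) (val C e'))"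
  | special_lam: "gobjs e \<subseteq> Obj C \<Longrightarrow> special C (Plus Zero e) e (lam C (val C e))"
  | special_rho: "gobjs e \<subseteq> Obj C \<Longrightarrow> special C (Plus e Zero) e (rho C (val C e))"
  | special_eps: "gobjs e \<subseteq> Obj C \<Longrightarrow> special C (Plus (Minus e) e) Zero (eps C (val C e))"
  | special_del: "gobjs e \<subseteq> Obj C \<Longrightarrow> special C (Plus e (Minus e)) Zero (del C (val C e))"
  | special_cmp: "\<lbrakk>special C d e f; special C e e' g\<rbrakk> \<Longrightarrow> special C d e' (cmp C g f)"
  | special_asum: "\<lbrakk>special C d d' f; special C e e' g\<rbrakk>
      \<Longrightarrow> special C (Plus d e) (Plus d' e') (asum C f g)"
  | special_inv: "special C d e f \<Longrightarrow> special C e d (arr_inv C f)"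

definition special_arrow :: "('o, 'a) catgrp \<Rightarrow> 'o gexp \<Rightarrow> 'o gexp \<Rightarrow> 'a"
  where "special_arrow C d e = (THE \<gamma>. special C d e \<gamma>)"


section \<open>c-groups and c-crossed modules\<close>

record 'g cgroup =
  elts :: "'g set"
  cong :: "('g \<times> 'g) set"
  add :: "'g \<Rightarrow> 'g \<Rightarrow> 'g"
  zer :: "'g"
  neg :: "'g \<Rightarrow> 'g"

locale c_group =
  fixes G :: "'g cgroup"
  assumes equiv_cong: "equiv (elts G) (cong G)"
    and add_closed: "\<lbrakk>a \<in> elts G; b \<in> elts G\<rbrakk> \<Longrightarrow> add G a b \<in> elts G"
    and add_cong: "\<lbrakk>(a, a') \<in> cong G; (b, b') \<in> cong G\<rbrakk> \<Longrightarrow> (add G a b, add G a' b') \<in> cong G"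
    and add_assoc: "\<lbrakk>a \<in> elts G; b \<in> elts G; c \<in> elts G\<rbrakk>
        \<Longrightarrow> (add G a (add G b c), add G (add G a b) c) \<in> cong G"
    and zer_in: "zer G \<in> elts G"
    and add_zer: "a \<in> elts G \<Longrightarrow> (add G a (zer G), a) \<in> cong G"
    and zer_add: "a \<in> elts G \<Longrightarrow> (a, add G (zer G) a) \<in> cong G"
    and neg_in: "a \<in> elts G \<Longrightarrow> neg G a \<in> elts G"
    and add_neg: "a \<in> elts G \<Longrightarrow> (add G a (neg G a), zer G) \<in> cong G"
    and neg_add: "a \<in> elts G \<Longrightarrow> (zer G, add G (neg G a) a) \<in> cong G"

locale c_group_morphism =
  G: c_group G + H: c_group H for G :: "'g cgroup" and H :: "'h cgroup" +
  fixes f :: "'g \<Rightarrow> 'h"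
  assumes map_in: "a \<in> elts G \<Longrightarrow> f a \<in> elts H"
    and map_cong: "(a, a') \<in> cong G \<Longrightarrow> (f a, f a') \<in> cong H"
    and map_add: "\<lbrakk>a \<in> elts G; b \<in> elts G\<rbrakk> \<Longrightarrow> f (add G a b) = add H (f a) (f b)"

locale c_group_action =
  H: c_group H + G: c_group G for H :: "'h cgroup" and G :: "'g cgroup" +
  fixes ac :: "'h \<Rightarrow> 'g \<Rightarrow> 'g"
  assumes act_in: "\<lbrakk>b \<in> elts H; a \<in> elts G\<rbrakk> \<Longrightarrow> ac b a \<in> elts G"
    and act_cong: "\<lbrakk>(b, b') \<in> cong H; (a, a') \<in> cong G\<rbrakk> \<Longrightarrow> (ac b a, ac b' a') \<in> cong G"
    and act_add: "\<lbrakk>b \<in> elts H; a \<in> elts G; a\<^sub>1 \<in> elts G\<rbrakk>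
        \<Longrightarrow> (ac b (add G a a\<^sub>1), add G (ac b a) (ac b a\<^sub>1)) \<in> cong G"
    and add_act: "\<lbrakk>b \<in> elts H; b\<^sub>1 \<in> elts H; a \<in> elts G\<rbrakk>
        \<Longrightarrow> (ac (add H b b\<^sub>1) a, ac b (ac b\<^sub>1 a)) \<in> cong G"
    and zer_act: "a \<in> elts G \<Longrightarrow> (ac (zer H) a, a) \<in> cong G"

record ('m, 'n) ccmod =
  Mgrp :: "'m cgroup"
  Ngrp :: "'n cgroup"
  bnd :: "'m \<Rightarrow> 'n"
  act :: "'n \<Rightarrow> 'm \<Rightarrow> 'm"

locale c_crossed_module =
  c_group_morphism "Mgrp X" "Ngrp X" "bnd X" + c_group_action "Ngrp X" "Mgrp X" "act X"
  for X :: "('m, 'n) ccmod" +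
  assumes bnd_act: "\<lbrakk>b \<in> elts (Ngrp X); a \<in> elts (Mgrp X)\<rbrakk>
        \<Longrightarrow> bnd X (act X b a) = add (Ngrp X) b (add (Ngrp X) (bnd X a) (neg (Ngrp X) b))"
    and peiffer: "\<lbrakk>a \<in> elts (Mgrp X); a\<^sub>1 \<in> elts (Mgrp X)\<rbrakk>
        \<Longrightarrow> (act X (bnd X a) a\<^sub>1, add (Mgrp X) a (add (Mgrp X) a\<^sub>1 (neg (Mgrp X) a))) \<in> cong (Mgrp X)"

locale c_crossed_module_morphism =
  X: c_crossed_module X + X': c_crossed_module X' +
  N_map: c_group_morphism "Ngrp X" "Ngrp X'" \<phi>\<^sub>0 +
  M_map: c_group_morphism "Mgrp X" "Mgrp X'" \<phi>\<^sub>1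
  for X :: "('m, 'n) ccmod" and X' :: "('p, 'q) ccmod"
    and \<phi>\<^sub>0 :: "'n \<Rightarrow> 'q" and \<phi>\<^sub>1 :: "'m \<Rightarrow> 'p" +
  assumes map_bnd: "a \<in> elts (Mgrp X) \<Longrightarrow> \<phi>\<^sub>0 (bnd X a) = bnd X' (\<phi>\<^sub>1 a)"
    and map_act: "\<lbrakk>b \<in> elts (Ngrp X); a \<in> elts (Mgrp X)\<rbrakk>
        \<Longrightarrow> \<phi>\<^sub>1 (act X b a) = act X' (\<phi>\<^sub>0 b) (\<phi>\<^sub>1 a)"


section \<open>The c-crossed module of a categorical group\<close>

definition obj_cgroup :: "('o, 'a) catgrp \<Rightarrow> 'o cgroup"
  where "obj_cgroup C = \<lparr>
    elts = Obj C,
    cong = {(x, y). x \<in> Obj C \<and> y \<in> Obj C \<and> obj_iso C x y},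
    add = osum C,
    zer = null C,
    neg = oneg C\<rparr>"

definition star :: "('o, 'a) catgrp \<Rightarrow> 'a set"
  where "star C = {f \<in> Arr C. src C f = null C}"

text \<open>The negative of \<open>f\<close> is \<open>\<boxminus>f\<close>, moved to source \<open>0\<close> by the special isomorphism
  \<open>0 \<rightarrow> -0\<close> just as the sum is moved by \<open>0 \<rightarrow> 0 + 0\<close>.\<close>

definition star_cgroup :: "('o, 'a) catgrp \<Rightarrow> 'a cgroup"
  where "star_cgroup C = \<lparr>
    elts = star C,
    cong = {(f, g). f \<in> star C \<and> g \<in> star C \<and> arr_iso C f g},
    add = (\<lambda>f f'. cmp C (asum C f f') (special_arrow C Zero (Plus Zero Zero))),
    zer = idt C (null C),
    neg = (\<lambda>f. cmp C (aneg C f) (special_arrow C Zero (Minus Zero)))\<rparr>"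

definition star_act :: "('o, 'a) catgrp \<Rightarrow> 'o \<Rightarrow> 'a \<Rightarrow> 'a"
  where "star_act C r c =
    cmp C (asum C (idt C r) (asum C c (aneg C (idt C r))))
      (special_arrow C Zero (Plus (Gen r) (Plus Zero (Minus (Gen r)))))"

definition star_ccmod :: "('o, 'a) catgrp \<Rightarrow> ('a, 'o) ccmod"
  where "star_ccmod C = \<lparr>
    Mgrp = star_cgroup C,
    Ngrp = obj_cgroup C,
    bnd = restrict (tgt C) (star C),
    act = star_act C\<rparr>"

end

theory Submission
  imports Defs
begin

text \<open>The special isomorphisms are definite descriptions, so the point is coherence: a special
  isomorphism is determined by its formal source and target. Choose a representative \<open>rep x\<close> in every
  isomorphism class of objects. For every formal expression \<open>e\<close> and every representative \<open>w\<close> there is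
  an arrow \<open>normal e w\<close> from \<open>e \<oplus> w\<close> to \<open>rep (e \<oplus> w)\<close>, chosen arbitrarily if \<open>e\<close> is a generator and
  forced by the categorical group structure otherwise. Every special \<open>f\<close> from \<open>d\<close> to \<open>e\<close> satisfies
  \<open>normal e w \<cdot> (f \<boxplus> \<one> w) = normal d w\<close>; since adding \<open>w\<close> is faithful, \<open>f\<close> is unique.

  Hence the special isomorphisms in the sum and the action are explicit composites of \<open>\<Lambda>\<close> and
  \<open>\<delta>\<close>, which are preserved by the morphism.\<close>

section \<open>Calculus of arrows in a groupoid\<close>

context small_groupoid
begin

lemma hom_iff: "f \<in> hom C x y \<longleftrightarrow> f \<in> Arr C \<and> src C f = x \<and> tgt C f = y"
  by (simp add: hom_def)

declare src_in [simp] tgt_in [simp]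

lemma idt_Arr [simp]: "x \<in> Obj C \<Longrightarrow> \<one> x \<in> Arr C"
  and src_idt [simp]: "x \<in> Obj C \<Longrightarrow> src C (\<one> x) = x"
  and tgt_idt [simp]: "x \<in> Obj C \<Longrightarrow> tgt C (\<one> x) = x"
  using idt_hom[of x] by (auto simp: hom_iff)

lemma cmp_Arr [simp]: "\<lbrakk>f \<in> Arr C; g \<in> Arr C; src C g = tgt C f\<rbrakk> \<Longrightarrow> g \<cdot> f \<in> Arr C"
  and src_cmp [simp]: "\<lbrakk>f \<in> Arr C; g \<in> Arr C; src C g = tgt C f\<rbrakk> \<Longrightarrow> src C (g \<cdot> f) = src C f"
  and tgt_cmp [simp]: "\<lbrakk>f \<in> Arr C; g \<in> Arr C; src C g = tgt C f\<rbrakk> \<Longrightarrow> tgt C (g \<cdot> f) = tgt C g"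
  using cmp_hom[of f "src C f" "tgt C f" g "tgt C g"] by (auto simp: hom_iff)

lemma idt_cmp [simp]: "\<lbrakk>f \<in> Arr C; tgt C f = y\<rbrakk> \<Longrightarrow> \<one> y \<cdot> f = f"
  and cmp_idt [simp]: "\<lbrakk>f \<in> Arr C; src C f = x\<rbrakk> \<Longrightarrow> f \<cdot> \<one> x = f"
  using idt_left[of f "src C f" "tgt C f"] idt_right[of f "src C f" "tgt C f"]
  by (auto simp: hom_iff)

text \<open>Oriented to the right: simplification turns every composite into its right-nested form,
  and later calculations state other bracketings explicitly where an axiom needs them.\<close>

lemma cmp_assoc' [simp]:
  "\<lbrakk>f \<in> Arr C; g \<in> Arr C; h \<in> Arr C; src C g = tgt C f; src C h = tgt C g\<rbrakk>
    \<Longrightarrow> (h \<cdot> g) \<cdot> f = h \<cdot> g \<cdot> f"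
  using cmp_assoc[of f "src C f" "tgt C f" g "tgt C g" h "tgt C h"] by (auto simp: hom_iff)

lemma inverse_arrows_unique:
  assumes "inverse_arrows C f g" "inverse_arrows C f g'"
  shows "g = g'"
  using assms unfolding inverse_arrows_def by (metis cmp_assoc idt_left idt_right hom_iff)

lemma arr_inv_eqI: "inverse_arrows C f g \<Longrightarrow> inv f = g"
  unfolding arr_inv_def by (blast intro: inverse_arrows_unique)

lemma inverse_arrows_inv: "f \<in> Arr C \<Longrightarrow> inverse_arrows C f (inv f)"
  using arrows_iso arr_inv_eqI unfolding is_iso_def by blast

lemma inv_Arr [simp]: "f \<in> Arr C \<Longrightarrow> inv f \<in> Arr C"
  and src_inv [simp]: "f \<in> Arr C \<Longrightarrow> src C (inv f) = tgt C f"
  and tgt_inv [simp]: "f \<in> Arr C \<Longrightarrow> tgt C (inv f) = src C f"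
  and inv_cmp [simp]: "f \<in> Arr C \<Longrightarrow> inv f \<cdot> f = \<one> (src C f)"
  and cmp_inv [simp]: "f \<in> Arr C \<Longrightarrow> f \<cdot> inv f = \<one> (tgt C f)"
  using inverse_arrows_inv[of f] by (auto simp: inverse_arrows_def hom_iff)

text \<open>In right-nested form \<open>inv f\<close> and \<open>f\<close> stand side by side
  without forming a subterm \<open>inv f \<cdot> f\<close>; this rule and the next cancel them
  there.\<close>

lemma inv_cmp_cmp [simp]:
  "\<lbrakk>f \<in> Arr C; g \<in> Arr C; src C f = tgt C g\<rbrakk> \<Longrightarrow> inv f \<cdot> f \<cdot> g = g"
  using cmp_assoc'[of g f "inv f"] by (simp del: cmp_assoc')

lemma cmp_inv_cmp [simp]:
  "\<lbrakk>f \<in> Arr C; g \<in> Arr C; tgt C f = tgt C g\<rbrakk> \<Longrightarrow> f \<cdot> inv f \<cdot> g = g"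
  using cmp_assoc'[of g "inv f" f] by (simp del: cmp_assoc')

lemma cmp_left_cancel:
  assumes "h \<cdot> f = h \<cdot> g" "f \<in> Arr C" "g \<in> Arr C" "h \<in> Arr C" "src C h = tgt C f" "src C h = tgt C g"
  shows "f = g"
  using assms by (metis inv_cmp_cmp)

lemma cmp_right_cancel:
  assumes "f \<cdot> h = g \<cdot> h" "f \<in> Arr C" "g \<in> Arr C" "h \<in> Arr C" "src C f = tgt C h" "src C g = tgt C h"
  shows "f = g"
proof -
  have "f \<cdot> h \<cdot> inv h = g \<cdot> h \<cdot> inv h"
    using assms by (metis cmp_assoc' inv_Arr src_inv tgt_inv)
  then show ?thesis
    using assms by (metis cmp_idt cmp_inv)
qed

section \<open>Isomorphism classes and their representatives\<close>

lemma obj_iso_iff: "obj_iso C x y \<longleftrightarrow> (\<exists>f \<in> Arr C. src C f = x \<and> tgt C f = y)"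
  using arrows_iso by (auto simp: obj_iso_def hom_iff)

lemma obj_isoI: "f \<in> Arr C \<Longrightarrow> obj_iso C (src C f) (tgt C f)"
  by (auto simp: obj_iso_iff)

lemma obj_iso_refl: "x \<in> Obj C \<Longrightarrow> obj_iso C x x"
  using obj_isoI[of "\<one> x"] by simp

lemma obj_iso_sym: "obj_iso C x y \<Longrightarrow> obj_iso C y x"
  unfolding obj_iso_iff by (metis inv_Arr src_inv tgt_inv)

lemma obj_iso_trans: "\<lbrakk>obj_iso C x y; obj_iso C y z\<rbrakk> \<Longrightarrow> obj_iso C x z"
  unfolding obj_iso_iff by (metis cmp_Arr src_cmp tgt_cmp)

lemma obj_iso_in: "obj_iso C x y \<Longrightarrow> x \<in> Obj C \<and> y \<in> Obj C"
  by (auto simp: obj_iso_iff)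

text \<open>An arrow \<open>h\<close> between the sources is completed by
  \<open>g \<cdot> h \<cdot> inv f\<close> on the targets, so no condition on the targets
  arises.\<close>

lemma arr_isoI:
  assumes "f \<in> Arr C" "g \<in> Arr C" "obj_iso C (src C f) (src C g)"
  shows "arr_iso C f g"
proof -
  obtain h where h: "h \<in> Arr C" "src C h = src C f" "tgt C h = src C g"
    using assms(3) by (auto simp: obj_iso_iff)
  then show ?thesis
    using assms arrows_iso unfolding arr_iso_def
    by (intro bexI[of _ h] bexI[of _ "g \<cdot> h \<cdot> inv f"]) (auto simp: hom_iff)
qed

text \<open>The choice depends on \<open>x\<close> only through the predicate
  \<open>obj_iso C x\<close>, so isomorphic objects get literally the same representative and arrows
  into it can be compared directly.\<close>

definition rep :: "'o \<Rightarrow> 'o"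
  where "rep x = (SOME y. obj_iso C x y)"

lemma obj_iso_rep: "x \<in> Obj C \<Longrightarrow> obj_iso C x (rep x)"
  unfolding rep_def by (rule someI, rule obj_iso_refl)

lemma rep_in [simp]: "x \<in> Obj C \<Longrightarrow> rep x \<in> Obj C"
  using obj_iso_rep obj_iso_in by blast

lemma rep_eq:
  assumes "obj_iso C x y"
  shows "rep x = rep y"
proof -
  have "obj_iso C x = obj_iso C y"
    using assms obj_iso_sym obj_iso_trans by blast
  then show ?thesis
    by (simp add: rep_def)
qed

lemma rep_src_tgt: "f \<in> Arr C \<Longrightarrow> rep (src C f) = rep (tgt C f)"
  by (simp add: obj_isoI rep_eq)

lemma rep_rep [simp]: "x \<in> Obj C \<Longrightarrow> rep (rep x) = rep x"
  using obj_iso_rep rep_eq by metis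

end

section \<open>Typing and naturality rules in a categorical group\<close>

context categorical_group
begin

declare null_in [simp] osum_in [simp] oneg_in [simp] asum_idt [simp]

lemma asum_Arr [simp]: "\<lbrakk>f \<in> Arr C; g \<in> Arr C\<rbrakk> \<Longrightarrow> f \<boxplus> g \<in> Arr C"
  and src_asum [simp]: "\<lbrakk>f \<in> Arr C; g \<in> Arr C\<rbrakk> \<Longrightarrow> src C (f \<boxplus> g) = src C f \<oplus> src C g"
  and tgt_asum [simp]: "\<lbrakk>f \<in> Arr C; g \<in> Arr C\<rbrakk> \<Longrightarrow> tgt C (f \<boxplus> g) = tgt C f \<oplus> tgt C g"
  using asum_hom[of f "src C f" "tgt C f" g "src C g" "tgt C g"] by (auto simp: hom_iff)

lemma aneg_Arr [simp]: "f \<in> Arr C \<Longrightarrow> \<boxminus> f \<in> Arr C"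
  and src_aneg [simp]: "f \<in> Arr C \<Longrightarrow> src C (\<boxminus> f) = \<ominus> src C f"
  and tgt_aneg [simp]: "f \<in> Arr C \<Longrightarrow> tgt C (\<boxminus> f) = \<ominus> tgt C f"
  using aneg_hom[of f "src C f" "tgt C f"] by (auto simp: hom_iff)

lemma alpha_Arr [simp]: "\<lbrakk>x \<in> Obj C; y \<in> Obj C; z \<in> Obj C\<rbrakk> \<Longrightarrow> \<alpha> x y z \<in> Arr C"
  and src_alpha [simp]: "\<lbrakk>x \<in> Obj C; y \<in> Obj C; z \<in> Obj C\<rbrakk> \<Longrightarrow> src C (\<alpha> x y z) = x \<oplus> y \<oplus> z"
  and tgt_alpha [simp]: "\<lbrakk>x \<in> Obj C; y \<in> Obj C; z \<in> Obj C\<rbrakk> \<Longrightarrow> tgt C (\<alpha> x y z) = x \<oplus> (y \<oplus> z)"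
  using alpha_hom[of x y z] by (auto simp: hom_iff)

lemma lam_Arr [simp]: "x \<in> Obj C \<Longrightarrow> \<Lambda> x \<in> Arr C"
  and src_lam [simp]: "x \<in> Obj C \<Longrightarrow> src C (\<Lambda> x) = \<zero> \<oplus> x"
  and tgt_lam [simp]: "x \<in> Obj C \<Longrightarrow> tgt C (\<Lambda> x) = x"
  using lam_hom[of x] by (auto simp: hom_iff)

lemma rho_Arr [simp]: "x \<in> Obj C \<Longrightarrow> \<rho> x \<in> Arr C"
  and src_rho [simp]: "x \<in> Obj C \<Longrightarrow> src C (\<rho> x) = x \<oplus> \<zero>"
  and tgt_rho [simp]: "x \<in> Obj C \<Longrightarrow> tgt C (\<rho> x) = x"
  using rho_hom[of x] by (auto simp: hom_iff)

lemma eps_Arr [simp]: "x \<in> Obj C \<Longrightarrow> \<epsilon> x \<in> Arr C"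
  and src_eps [simp]: "x \<in> Obj C \<Longrightarrow> src C (\<epsilon> x) = \<ominus> x \<oplus> x"
  and tgt_eps [simp]: "x \<in> Obj C \<Longrightarrow> tgt C (\<epsilon> x) = \<zero>"
  using eps_hom[of x] by (auto simp: hom_iff)

lemma del_Arr [simp]: "x \<in> Obj C \<Longrightarrow> \<delta> x \<in> Arr C"
  and src_del [simp]: "x \<in> Obj C \<Longrightarrow> src C (\<delta> x) = x \<oplus> \<ominus> x"
  and tgt_del [simp]: "x \<in> Obj C \<Longrightarrow> tgt C (\<delta> x) = \<zero>"
  using del_hom[of x] by (auto simp: hom_iff)

lemma interchange:
  "\<lbrakk>f \<in> Arr C; f' \<in> Arr C; g \<in> Arr C; g' \<in> Arr C; src C f' = tgt C f; src C g' = tgt C g\<rbrakk>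
    \<Longrightarrow> (f' \<boxplus> g') \<cdot> (f \<boxplus> g) = (f' \<cdot> f) \<boxplus> (g' \<cdot> g)"
  using asum_cmp[of f "src C f" "tgt C f" f' "tgt C f'" g "src C g" "tgt C g" g' "tgt C g'"]
  by (simp add: hom_iff)

text \<open>The objects are read off as sources and targets, so that naturality can be instantiated
  by arrows alone.\<close>

lemma alpha_nat:
  "\<lbrakk>f \<in> Arr C; g \<in> Arr C; h \<in> Arr C\<rbrakk>
    \<Longrightarrow> \<alpha> (tgt C f) (tgt C g) (tgt C h) \<cdot> ((f \<boxplus> g) \<boxplus> h)
      = (f \<boxplus> (g \<boxplus> h)) \<cdot> \<alpha> (src C f) (src C g) (src C h)"
  by (rule alpha_natural) (auto simp: hom_iff)

lemma lam_nat: "f \<in> Arr C \<Longrightarrow> \<Lambda> (tgt C f) \<cdot> (\<one> \<zero> \<boxplus> f) = f \<cdot> \<Lambda> (src C f)"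
  by (rule lam_natural) (auto simp: hom_iff)

lemma rho_nat: "f \<in> Arr C \<Longrightarrow> \<rho> (tgt C f) \<cdot> (f \<boxplus> \<one> \<zero>) = f \<cdot> \<rho> (src C f)"
  by (rule rho_natural) (auto simp: hom_iff)

section \<open>Faithfulness of sums and derived coherence equations\<close>

text \<open>Naturality of \<open>\<Lambda>\<close> recovers \<open>f\<close> from
  \<open>\<one> \<zero> \<boxplus> f\<close> by conjugation.\<close>

lemma asum_null_faithful:
  assumes "\<one> \<zero> \<boxplus> f = \<one> \<zero> \<boxplus> g" "f \<in> Arr C" "g \<in> Arr C" "src C f = src C g" "tgt C f = tgt C g"
  shows "f = g"
proof (rule cmp_right_cancel)
  show "f \<cdot> \<Lambda> (src C f) = g \<cdot> \<Lambda> (src C f)"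
    using lam_nat[of f] lam_nat[of g] assms by simp
qed (use assms in auto)

text \<open>Adding \<open>\<ominus> w\<close> as well and reassociating gives the equation for
  \<open>w \<oplus> \<ominus> w\<close>; \<open>\<delta> w\<close> contracts this to
  \<open>\<zero>\<close>, and naturality of \<open>\<rho>\<close> removes
  \<open>\<zero>\<close>.\<close>

lemma asum_idt_faithful:
  assumes eq: "f \<boxplus> \<one> w = g \<boxplus> \<one> w"
    and fg: "f \<in> Arr C" "g \<in> Arr C" "src C f = src C g" "tgt C f = tgt C g"
    and w: "w \<in> Obj C"
  shows "f = g"
proof -
  let ?x = "src C f" and ?y = "tgt C f"
  have "f \<boxplus> \<one> (w \<oplus> \<ominus> w) = g \<boxplus> \<one> (w \<oplus> \<ominus> w)"
  proof (rule cmp_right_cancel)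
    show "(f \<boxplus> \<one> (w \<oplus> \<ominus> w)) \<cdot> \<alpha> ?x w (\<ominus> w) = (g \<boxplus> \<one> (w \<oplus> \<ominus> w)) \<cdot> \<alpha> ?x w (\<ominus> w)"
      using alpha_nat[of f "\<one> w" "\<one> (\<ominus> w)"] alpha_nat[of g "\<one> w" "\<one> (\<ominus> w)"] eq fg w
      by simp
  qed (use fg w in auto)
  then have "(\<one> ?y \<boxplus> \<delta> w) \<cdot> (f \<boxplus> \<one> (w \<oplus> \<ominus> w)) = (\<one> ?y \<boxplus> \<delta> w) \<cdot> (g \<boxplus> \<one> (w \<oplus> \<ominus> w))"
    by simp
  then have *: "f \<boxplus> \<delta> w = g \<boxplus> \<delta> w"
    using fg w by (simp add: interchange)
  have "f \<boxplus> \<one> \<zero> = g \<boxplus> \<one> \<zero>"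
  proof (rule cmp_right_cancel)
    show "(f \<boxplus> \<one> \<zero>) \<cdot> (\<one> ?x \<boxplus> \<delta> w) = (g \<boxplus> \<one> \<zero>) \<cdot> (\<one> ?x \<boxplus> \<delta> w)"
      using * fg w by (simp add: interchange)
  qed (use fg w in auto)
  then have "f \<cdot> \<rho> ?x = g \<cdot> \<rho> ?x"
    using rho_nat[of f] rho_nat[of g] fg by simp
  then show ?thesis
    by (rule cmp_right_cancel) (use fg in auto)
qed

text \<open>Kelly's argument: adding \<open>\<zero>\<close> on the left is faithful, and after adding it the equation follows
  from the pentagon for \<open>\<zero>, \<zero>, x, y\<close>.\<close>

lemma lam_osum:
  assumes [simp]: "x \<in> Obj C" "y \<in> Obj C"
  shows "\<Lambda> (x \<oplus> y) \<cdot> \<alpha> \<zero> x y = \<Lambda> x \<boxplus> \<one> y"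
proof (rule asum_null_faithful)
  \<comment> \<open>\<open>?u\<close> is what precedes
    \<open>\<one> \<zero> \<boxplus> \<alpha> \<zero> x y\<close> on the longer side of the
    pentagon; being invertible, it can be cancelled afterwards.\<close>
  let ?u = "\<alpha> \<zero> (\<zero> \<oplus> x) y \<cdot> (\<alpha> \<zero> \<zero> x \<boxplus> \<one> y)"
  show "\<one> \<zero> \<boxplus> \<Lambda> (x \<oplus> y) \<cdot> \<alpha> \<zero> x y = \<one> \<zero> \<boxplus> (\<Lambda> x \<boxplus> \<one> y)"
  proof (rule cmp_right_cancel)
    have "(\<one> \<zero> \<boxplus> \<Lambda> (x \<oplus> y) \<cdot> \<alpha> \<zero> x y) \<cdot> ?u
        = (\<one> \<zero> \<boxplus> \<Lambda> (x \<oplus> y)) \<cdot> ((\<one> \<zero> \<boxplus> \<alpha> \<zero> x y) \<cdot> ?u)"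
      using interchange[of "\<one> \<zero>" "\<one> \<zero>" "\<alpha> \<zero> x y" "\<Lambda> (x \<oplus> y)", symmetric] by simp
    also have "\<dots> = ((\<one> \<zero> \<boxplus> \<Lambda> (x \<oplus> y)) \<cdot> \<alpha> \<zero> \<zero> (x \<oplus> y)) \<cdot> \<alpha> (\<zero> \<oplus> \<zero>) x y"
      by (simp add: pentagon[symmetric])
    also have "\<dots> = (\<rho> \<zero> \<boxplus> \<one> (x \<oplus> y)) \<cdot> \<alpha> (\<zero> \<oplus> \<zero>) x y"
      by (simp only: triangle assms null_in osum_in)
    also have "\<dots> = \<alpha> \<zero> x y \<cdot> ((\<rho> \<zero> \<boxplus> \<one> x) \<boxplus> \<one> y)"
      using alpha_nat[of "\<rho> \<zero>" "\<one> x" "\<one> y"] by simp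
    \<comment> \<open>The triangle is used a second time, now backwards and for
      \<open>\<zero>\<close> and \<open>x\<close>.\<close>
    also have "\<dots> = \<alpha> \<zero> x y \<cdot> (((\<one> \<zero> \<boxplus> \<Lambda> x) \<boxplus> \<one> y) \<cdot> (\<alpha> \<zero> \<zero> x \<boxplus> \<one> y))"
      by (simp add: interchange triangle)
    also have "\<dots> = (\<alpha> \<zero> x y \<cdot> ((\<one> \<zero> \<boxplus> \<Lambda> x) \<boxplus> \<one> y)) \<cdot> (\<alpha> \<zero> \<zero> x \<boxplus> \<one> y)"
      by simp
    also have "\<dots> = (\<one> \<zero> \<boxplus> (\<Lambda> x \<boxplus> \<one> y)) \<cdot> ?u"
      using alpha_nat[of "\<one> \<zero>" "\<Lambda> x" "\<one> y"] by simp
    finally show "(\<one> \<zero> \<boxplus> \<Lambda> (x \<oplus> y) \<cdot> \<alpha> \<zero> x y) \<cdot> ?u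
      = (\<one> \<zero> \<boxplus> (\<Lambda> x \<boxplus> \<one> y)) \<cdot> ?u" .
  qed auto
qed auto

text \<open>This is \<open>inverse_triangle1\<close> with a further summand \<open>w\<close>,
  carried along by the pentagon, the triangle and \<open>lam_osum\<close>: in
  \<open>x \<oplus> (\<ominus> x \<oplus> (x \<oplus> w))\<close> it makes no difference which
  adjacent pair is contracted.\<close>

lemma del_osum:
  assumes [simp]: "x \<in> Obj C" "w \<in> Obj C"
  shows "(\<one> x \<boxplus> \<Lambda> w \<cdot> (\<epsilon> x \<boxplus> \<one> w) \<cdot> inv (\<alpha> (\<ominus> x) x w)) \<cdot> \<alpha> x (\<ominus> x) (x \<oplus> w)
    = \<Lambda> (x \<oplus> w) \<cdot> (\<delta> x \<boxplus> \<one> (x \<oplus> w))"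
    (is "(_ \<boxplus> ?l \<cdot> ?e \<cdot> inv ?a) \<cdot> ?b = ?r")
proof (rule cmp_right_cancel)
  \<comment> \<open>\<open>inverse_triangle1\<close> with its inverses cleared.\<close>
  have 1: "\<rho> x \<cdot> (\<one> x \<boxplus> \<epsilon> x) \<cdot> \<alpha> x (\<ominus> x) x = \<Lambda> x \<cdot> (\<delta> x \<boxplus> \<one> x)"
  proof (rule cmp_right_cancel)
    show "(\<rho> x \<cdot> (\<one> x \<boxplus> \<epsilon> x) \<cdot> \<alpha> x (\<ominus> x) x) \<cdot> (inv (\<delta> x) \<boxplus> \<one> x)
      = (\<Lambda> x \<cdot> (\<delta> x \<boxplus> \<one> x)) \<cdot> (inv (\<delta> x) \<boxplus> \<one> x)"
      using inverse_triangle1[of x] by (simp add: interchange)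
  qed auto
  \<comment> \<open>After composition with \<open>\<alpha> (x \<oplus> \<ominus> x) x w\<close>, the
    factor \<open>?b\<close> completes one side of the pentagon; the other side supplies the
    \<open>?a\<close> that cancels \<open>inv ?a\<close>.\<close>
  have "((\<one> x \<boxplus> ?l \<cdot> ?e \<cdot> inv ?a) \<cdot> ?b) \<cdot> \<alpha> (x \<oplus> \<ominus> x) x w
      = (\<one> x \<boxplus> ?l \<cdot> ?e \<cdot> inv ?a) \<cdot> (\<one> x \<boxplus> ?a) \<cdot> \<alpha> x (\<ominus> x \<oplus> x) w \<cdot> (\<alpha> x (\<ominus> x) x \<boxplus> \<one> w)"
    by (simp add: pentagon)
  also have "\<dots> = ((\<one> x \<boxplus> ?l \<cdot> ?e \<cdot> inv ?a) \<cdot> (\<one> x \<boxplus> ?a)) \<cdot> \<alpha> x (\<ominus> x \<oplus> x) w \<cdot> (\<alpha> x (\<ominus> x) x \<boxplus> \<one> w)"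
    by simp
  also have "(\<one> x \<boxplus> ?l \<cdot> ?e \<cdot> inv ?a) \<cdot> (\<one> x \<boxplus> ?a) = (\<one> x \<boxplus> \<Lambda> w) \<cdot> (\<one> x \<boxplus> (\<epsilon> x \<boxplus> \<one> w))"
    by (simp add: interchange)
  also have "((\<one> x \<boxplus> \<Lambda> w) \<cdot> (\<one> x \<boxplus> (\<epsilon> x \<boxplus> \<one> w))) \<cdot> \<alpha> x (\<ominus> x \<oplus> x) w \<cdot> (\<alpha> x (\<ominus> x) x \<boxplus> \<one> w)
      = (\<one> x \<boxplus> \<Lambda> w) \<cdot> ((\<one> x \<boxplus> (\<epsilon> x \<boxplus> \<one> w)) \<cdot> \<alpha> x (\<ominus> x \<oplus> x) w) \<cdot> (\<alpha> x (\<ominus> x) x \<boxplus> \<one> w)"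
    by simp
  also have "(\<one> x \<boxplus> (\<epsilon> x \<boxplus> \<one> w)) \<cdot> \<alpha> x (\<ominus> x \<oplus> x) w = \<alpha> x \<zero> w \<cdot> ((\<one> x \<boxplus> \<epsilon> x) \<boxplus> \<one> w)"
    using alpha_nat[of "\<one> x" "\<epsilon> x" "\<one> w"] by simp
  also have "(\<one> x \<boxplus> \<Lambda> w) \<cdot> (\<alpha> x \<zero> w \<cdot> ((\<one> x \<boxplus> \<epsilon> x) \<boxplus> \<one> w)) \<cdot> (\<alpha> x (\<ominus> x) x \<boxplus> \<one> w)
      = ((\<one> x \<boxplus> \<Lambda> w) \<cdot> \<alpha> x \<zero> w) \<cdot> ((\<one> x \<boxplus> \<epsilon> x) \<boxplus> \<one> w) \<cdot> (\<alpha> x (\<ominus> x) x \<boxplus> \<one> w)"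
    by simp
  also have "(\<one> x \<boxplus> \<Lambda> w) \<cdot> \<alpha> x \<zero> w = \<rho> x \<boxplus> \<one> w"
    by (simp add: triangle)
  also have "(\<rho> x \<boxplus> \<one> w) \<cdot> ((\<one> x \<boxplus> \<epsilon> x) \<boxplus> \<one> w) \<cdot> (\<alpha> x (\<ominus> x) x \<boxplus> \<one> w)
      = (\<Lambda> x \<boxplus> \<one> w) \<cdot> ((\<delta> x \<boxplus> \<one> x) \<boxplus> \<one> w)"
    by (simp add: interchange 1)
  also have "\<dots> = (\<Lambda> (x \<oplus> w) \<cdot> \<alpha> \<zero> x w) \<cdot> ((\<delta> x \<boxplus> \<one> x) \<boxplus> \<one> w)"
    by (simp only: lam_osum assms)
  also have "\<dots> = \<Lambda> (x \<oplus> w) \<cdot> (\<alpha> \<zero> x w \<cdot> ((\<delta> x \<boxplus> \<one> x) \<boxplus> \<one> w))"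
    by simp
  also have "\<alpha> \<zero> x w \<cdot> ((\<delta> x \<boxplus> \<one> x) \<boxplus> \<one> w) = (\<delta> x \<boxplus> \<one> (x \<oplus> w)) \<cdot> \<alpha> (x \<oplus> \<ominus> x) x w"
    using alpha_nat[of "\<delta> x" "\<one> x" "\<one> w"] by simp
  also have "\<Lambda> (x \<oplus> w) \<cdot> (\<delta> x \<boxplus> \<one> (x \<oplus> w)) \<cdot> \<alpha> (x \<oplus> \<ominus> x) x w = ?r \<cdot> \<alpha> (x \<oplus> \<ominus> x) x w"
    by simp
  finally show "((\<one> x \<boxplus> ?l \<cdot> ?e \<cdot> inv ?a) \<cdot> ?b) \<cdot> \<alpha> (x \<oplus> \<ominus> x) x w = ?r \<cdot> \<alpha> (x \<oplus> \<ominus> x) x w" .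
qed auto

section \<open>Representatives of sums\<close>

text \<open>This and the next four rules compute the sources and targets that occur in
  \<open>normal\<close>; each holds because some arrow connects the objects concerned.\<close>

lemma rep_osum_rep [simp]:
  assumes "x \<in> Obj C" "y \<in> Obj C"
  shows "rep (x \<oplus> rep y) = rep (x \<oplus> y)"
proof -
  obtain f where "f \<in> Arr C" "src C f = y" "tgt C f = rep y"
    using obj_iso_rep assms by (auto simp: obj_iso_iff)
  then show ?thesis
    using rep_src_tgt[of "\<one> x \<boxplus> f"] assms by simp
qed

lemma rep_osum_assoc [simp]:
  "\<lbrakk>x \<in> Obj C; y \<in> Obj C; z \<in> Obj C\<rbrakk> \<Longrightarrow> rep (x \<oplus> y \<oplus> z) = rep (x \<oplus> (y \<oplus> z))"
  using rep_src_tgt[of "\<alpha> x y z"] by simp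

lemma rep_null_osum [simp]: "x \<in> Obj C \<Longrightarrow> rep (\<zero> \<oplus> x) = rep x"
  using rep_src_tgt[of "\<Lambda> x"] by simp

lemma rep_oneg_osum [simp]:
  assumes "x \<in> Obj C" "y \<in> Obj C"
  shows "rep (\<ominus> x \<oplus> (x \<oplus> y)) = rep y"
  using rep_src_tgt[of "\<epsilon> x \<boxplus> \<one> y"] assms by simp

lemma rep_osum_oneg [simp]:
  assumes "x \<in> Obj C" "y \<in> Obj C"
  shows "rep (x \<oplus> (\<ominus> x \<oplus> y)) = rep y"
  using rep_src_tgt[of "\<delta> x \<boxplus> \<one> y"] assms by simp

section \<open>Normalising arrows of formal expressions\<close>

lemma val_in [simp]: "gobjs e \<subseteq> Obj C \<Longrightarrow> val C e \<in> Obj C"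
  by (induction e) auto

text \<open>For \<open>Minus e\<close> the arrow undoes \<open>normal e w'\<close>, where \<open>w'\<close> is chosen such that \<open>rep (e \<oplus> w') = w\<close>.\<close>

primrec normal :: "'o gexp \<Rightarrow> 'o \<Rightarrow> 'a"
  where
    "normal (Gen x) w = (SOME f. f \<in> hom C (x \<oplus> w) (rep (x \<oplus> w)))"
  | "normal Zero w = \<Lambda> w"
  | "normal (Plus d e) w =
      normal d (rep (val C e \<oplus> w)) \<cdot> (\<one> (val C d) \<boxplus> normal e w) \<cdot> \<alpha> (val C d) (val C e) w"
  | "normal (Minus e) w =
      (let x = val C e; w' = rep (\<ominus> x \<oplus> w)
       in \<Lambda> w' \<cdot> (\<epsilon> x \<boxplus> \<one> w') \<cdot> inv (\<alpha> (\<ominus> x) x w') \<cdot> (\<one> (\<ominus> x) \<boxplus> inv (normal e w')))"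

text \<open>Restricting \<open>w\<close> to representatives makes \<open>\<Lambda> w\<close> end at
  \<open>rep (\<zero> \<oplus> w)\<close>, and makes the inverse arrow in the \<open>Minus\<close>
  case start at \<open>w\<close> itself.\<close>

lemma normal_hom:
  "\<lbrakk>gobjs e \<subseteq> Obj C; w \<in> Obj C; rep w = w\<rbrakk>
    \<Longrightarrow> normal e w \<in> hom C (val C e \<oplus> w) (rep (val C e \<oplus> w))"
proof (induction e arbitrary: w)
  case (Gen x)
  then have "x \<oplus> w \<in> Obj C"
    by simp
  from obj_iso_rep[OF this] show ?case
    by (auto simp: obj_iso_iff hom_iff intro: someI2)
qed (auto simp: hom_iff Let_def)

lemma normal_Arr [simp]:
  "\<lbrakk>gobjs e \<subseteq> Obj C; w \<in> Obj C; rep w = w\<rbrakk> \<Longrightarrow> normal e w \<in> Arr C"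
  and src_normal [simp]:
  "\<lbrakk>gobjs e \<subseteq> Obj C; w \<in> Obj C; rep w = w\<rbrakk> \<Longrightarrow> src C (normal e w) = val C e \<oplus> w"
  and tgt_normal [simp]:
  "\<lbrakk>gobjs e \<subseteq> Obj C; w \<in> Obj C; rep w = w\<rbrakk> \<Longrightarrow> tgt C (normal e w) = rep (val C e \<oplus> w)"
  using normal_hom[of e w] by (auto simp: hom_iff)

lemma special_hom:
  "special C d e f \<Longrightarrow>
    gobjs d \<subseteq> Obj C \<and> gobjs e \<subseteq> Obj C \<and> f \<in> hom C (val C d) (val C e)"
  by (induction rule: special.induct) (auto simp: hom_iff)

text \<open>Both bracketings absorb \<open>e'\<close>, \<open>e\<close> and \<open>d\<close> in this
  order; they differ only in associators, which the pentagon and naturality of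
  \<open>\<alpha>\<close> match up.\<close>

lemma normal_alpha:
  assumes [simp]: "gobjs d \<subseteq> Obj C" "gobjs e \<subseteq> Obj C" "gobjs e' \<subseteq> Obj C" "w \<in> Obj C" "rep w = w"
  shows "normal (Plus d (Plus e e')) w \<cdot> (\<alpha> (val C d) (val C e) (val C e') \<boxplus> \<one> w)
    = normal (Plus (Plus d e) e') w"
proof -
  define x y z where [simp]: "x = val C d" "y = val C e" "z = val C e'"
  let ?N = "normal d (rep (y \<oplus> (z \<oplus> w)))" and ?A = "normal e (rep (z \<oplus> w))" and ?B = "normal e' w"
  have "normal (Plus d (Plus e e')) w \<cdot> (\<alpha> x y z \<boxplus> \<one> w)
      = ?N \<cdot> (\<one> x \<boxplus> ?A \<cdot> (\<one> y \<boxplus> ?B) \<cdot> \<alpha> y z w) \<cdot> \<alpha> x (y \<oplus> z) w \<cdot> (\<alpha> x y z \<boxplus> \<one> w)"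
    by simp
  also have "\<one> x \<boxplus> ?A \<cdot> (\<one> y \<boxplus> ?B) \<cdot> \<alpha> y z w
      = (\<one> x \<boxplus> ?A) \<cdot> (\<one> x \<boxplus> (\<one> y \<boxplus> ?B)) \<cdot> (\<one> x \<boxplus> \<alpha> y z w)"
    by (simp add: interchange)
  also have "?N \<cdot> \<dots> \<cdot> \<alpha> x (y \<oplus> z) w \<cdot> (\<alpha> x y z \<boxplus> \<one> w)
      = ?N \<cdot> (\<one> x \<boxplus> ?A) \<cdot> (\<one> x \<boxplus> (\<one> y \<boxplus> ?B)) \<cdot> \<alpha> x y (z \<oplus> w) \<cdot> \<alpha> (x \<oplus> y) z w"
    by (simp add: pentagon)
  also have "\<dots> = ?N \<cdot> (\<one> x \<boxplus> ?A) \<cdot> ((\<one> x \<boxplus> (\<one> y \<boxplus> ?B)) \<cdot> \<alpha> x y (z \<oplus> w)) \<cdot> \<alpha> (x \<oplus> y) z w"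
    by simp
  also have "(\<one> x \<boxplus> (\<one> y \<boxplus> ?B)) \<cdot> \<alpha> x y (z \<oplus> w)
      = \<alpha> x y (rep (z \<oplus> w)) \<cdot> (\<one> (x \<oplus> y) \<boxplus> ?B)"
    using alpha_nat[of "\<one> x" "\<one> y" ?B] by simp
  also have "?N \<cdot> (\<one> x \<boxplus> ?A) \<cdot> \<dots> \<cdot> \<alpha> (x \<oplus> y) z w = normal (Plus (Plus d e) e') w"
    by simp
  finally show ?thesis
    by simp
qed

text \<open>First \<open>g\<close> is absorbed at \<open>w\<close>, then \<open>f\<close> at
  \<open>rep (val C e' \<oplus> w)\<close>; this is why the assumption on \<open>f\<close> ranges
  over all representatives.\<close>

lemma normal_asum:
  assumes nf: "\<And>w. \<lbrakk>w \<in> Obj C; rep w = w\<rbrakk> \<Longrightarrow> normal d' w \<cdot> (f \<boxplus> \<one> w) = normal d w"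
    and ng: "normal e' w \<cdot> (g \<boxplus> \<one> w) = normal e w"
    and f: "f \<in> Arr C" "src C f = val C d" "tgt C f = val C d'"
    and g: "g \<in> Arr C" "src C g = val C e" "tgt C g = val C e'"
    and [simp]: "gobjs d \<subseteq> Obj C" "gobjs d' \<subseteq> Obj C" "gobjs e \<subseteq> Obj C" "gobjs e' \<subseteq> Obj C"
    and [simp]: "w \<in> Obj C" "rep w = w"
  shows "normal (Plus d' e') w \<cdot> ((f \<boxplus> g) \<boxplus> \<one> w) = normal (Plus d e) w"
proof -
  define x x' y y' where [simp]: "x = val C d" "x' = val C d'" "y = val C e" "y' = val C e'"
  have rep: "rep (y \<oplus> w) = rep (y' \<oplus> w)"
    using rep_src_tgt[of "g \<boxplus> \<one> w"] g by simp
  let ?w = "rep (y' \<oplus> w)"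
  have "normal (Plus d' e') w \<cdot> ((f \<boxplus> g) \<boxplus> \<one> w)
      = normal d' ?w \<cdot> (\<one> x' \<boxplus> normal e' w) \<cdot> (\<alpha> x' y' w \<cdot> ((f \<boxplus> g) \<boxplus> \<one> w))"
    using f g by simp
  also have "\<alpha> x' y' w \<cdot> ((f \<boxplus> g) \<boxplus> \<one> w) = (f \<boxplus> (g \<boxplus> \<one> w)) \<cdot> \<alpha> x y w"
    using alpha_nat[of f g "\<one> w"] f g by simp
  also have "normal d' ?w \<cdot> (\<one> x' \<boxplus> normal e' w) \<cdot> \<dots>
      = normal d' ?w \<cdot> ((\<one> x' \<boxplus> normal e' w) \<cdot> (f \<boxplus> (g \<boxplus> \<one> w))) \<cdot> \<alpha> x y w"
    using f g by simp
  \<comment> \<open>By interchange both sides equal \<open>f \<boxplus> normal e w\<close>.\<close>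
  also have "(\<one> x' \<boxplus> normal e' w) \<cdot> (f \<boxplus> (g \<boxplus> \<one> w)) = (f \<boxplus> \<one> ?w) \<cdot> (\<one> x \<boxplus> normal e w)"
    using f g ng rep by (simp add: interchange)
  also have "normal d' ?w \<cdot> \<dots> \<cdot> \<alpha> x y w
      = (normal d' ?w \<cdot> (f \<boxplus> \<one> ?w)) \<cdot> (\<one> x \<boxplus> normal e w) \<cdot> \<alpha> x y w"
    using f g rep by simp
  also have "\<dots> = normal (Plus d e) w"
    using nf[of ?w] rep by simp
  finally show ?thesis .
qed

text \<open>The definition for \<open>Minus\<close> brings in the inverse of
  \<open>normal e w'\<close>. Composing with \<open>normal e w'\<close> in the last summand cancels
  it and reduces the claim to \<open>del_osum\<close>.\<close>

lemma normal_del: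
  assumes [simp]: "gobjs e \<subseteq> Obj C" "w \<in> Obj C" "rep w = w"
  shows "\<Lambda> w \<cdot> (\<delta> (val C e) \<boxplus> \<one> w) = normal (Plus e (Minus e)) w"
proof (rule cmp_right_cancel)
  let ?x = "val C e"
  define w' where w': "w' = rep (\<ominus> ?x \<oplus> w)"
  have [simp]: "w' \<in> Obj C" "rep w' = w'" "rep (?x \<oplus> w') = w"
    by (simp_all add: w')
  have [simp]: "rep (\<ominus> ?x \<oplus> w) = w'"
    by (simp add: w')
  let ?N = "normal e w'"
  let ?h = "\<Lambda> w' \<cdot> (\<epsilon> ?x \<boxplus> \<one> w') \<cdot> inv (\<alpha> (\<ominus> ?x) ?x w')"
  let ?b = "\<alpha> ?x (\<ominus> ?x) (?x \<oplus> w')"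
  have h [simp]: "?h \<in> Arr C" "src C ?h = \<ominus> ?x \<oplus> (?x \<oplus> w')" "tgt C ?h = w'"
    by auto
  \<comment> \<open>The outer \<open>normal e\<close> is taken at the representative left after
    absorbing \<open>Minus e\<close>, which is the same \<open>w'\<close> as in the definition for
    \<open>Minus\<close>.\<close>
  have "normal (Plus e (Minus e)) w \<cdot> (\<one> (?x \<oplus> \<ominus> ?x) \<boxplus> ?N)
      = ?N \<cdot> (\<one> ?x \<boxplus> ?h \<cdot> (\<one> (\<ominus> ?x) \<boxplus> inv ?N)) \<cdot> (\<alpha> ?x (\<ominus> ?x) w \<cdot> ((\<one> ?x \<boxplus> \<one> (\<ominus> ?x)) \<boxplus> ?N))"
    by (simp add: Let_def)
  also have "\<alpha> ?x (\<ominus> ?x) w \<cdot> ((\<one> ?x \<boxplus> \<one> (\<ominus> ?x)) \<boxplus> ?N) = (\<one> ?x \<boxplus> (\<one> (\<ominus> ?x) \<boxplus> ?N)) \<cdot> ?b"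
    using alpha_nat[of "\<one> ?x" "\<one> (\<ominus> ?x)" ?N] by simp
  also have "?N \<cdot> (\<one> ?x \<boxplus> ?h \<cdot> (\<one> (\<ominus> ?x) \<boxplus> inv ?N)) \<cdot> \<dots>
      = ?N \<cdot> ((\<one> ?x \<boxplus> ?h \<cdot> (\<one> (\<ominus> ?x) \<boxplus> inv ?N)) \<cdot> (\<one> ?x \<boxplus> (\<one> (\<ominus> ?x) \<boxplus> ?N))) \<cdot> ?b"
    by simp
  also have "(\<one> ?x \<boxplus> ?h \<cdot> (\<one> (\<ominus> ?x) \<boxplus> inv ?N)) \<cdot> (\<one> ?x \<boxplus> (\<one> (\<ominus> ?x) \<boxplus> ?N)) = \<one> ?x \<boxplus> ?h"
    by (simp add: interchange)
  also have "(\<one> ?x \<boxplus> ?h) \<cdot> ?b = \<Lambda> (?x \<oplus> w') \<cdot> (\<delta> ?x \<boxplus> \<one> (?x \<oplus> w'))"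
    by (rule del_osum) auto
  also have "?N \<cdot> \<dots> = (?N \<cdot> \<Lambda> (?x \<oplus> w')) \<cdot> (\<delta> ?x \<boxplus> \<one> (?x \<oplus> w'))"
    by simp
  also have "?N \<cdot> \<Lambda> (?x \<oplus> w') = \<Lambda> w \<cdot> (\<one> \<zero> \<boxplus> ?N)"
    using lam_nat[of ?N] by simp
  also have "\<dots> \<cdot> (\<delta> ?x \<boxplus> \<one> (?x \<oplus> w')) = (\<Lambda> w \<cdot> (\<delta> ?x \<boxplus> \<one> w)) \<cdot> (\<one> (?x \<oplus> \<ominus> ?x) \<boxplus> ?N)"
    by (simp add: interchange)
  finally show "(\<Lambda> w \<cdot> (\<delta> (val C e) \<boxplus> \<one> w)) \<cdot> (\<one> (val C e \<oplus> \<ominus> val C e) \<boxplus> normal e (rep (\<ominus> val C e \<oplus> w)))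
      = normal (Plus e (Minus e)) w \<cdot> (\<one> (val C e \<oplus> \<ominus> val C e) \<boxplus> normal e (rep (\<ominus> val C e \<oplus> w)))"
    by (simp only: w')
qed (auto simp: Let_def)

text \<open>By induction on the generation of \<open>f\<close>. The case \<open>\<Lambda>\<close>
  rests on \<open>lam_osum\<close>, \<open>\<rho>\<close> on the triangle; \<open>\<epsilon>\<close>
  is built into \<open>normal\<close> on \<open>Minus\<close>, while \<open>\<delta>\<close> needs
  the inverse triangle through \<open>normal_del\<close>.\<close>

lemma normal_special:
  "\<lbrakk>special C d e f; w \<in> Obj C; rep w = w\<rbrakk> \<Longrightarrow> normal e w \<cdot> (f \<boxplus> \<one> w) = normal d w"
proof (induction arbitrary: w rule: special.induct)
  case (special_idt e)
  then show ?case by simp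
next
  case (special_alpha d e e')
  then show ?case by (rule normal_alpha)
next
  case (special_lam e)
  then have "normal (Plus Zero e) w = (\<Lambda> (rep (val C e \<oplus> w)) \<cdot> (\<one> \<zero> \<boxplus> normal e w)) \<cdot> \<alpha> \<zero> (val C e) w"
    by simp
  also have "\<dots> = normal e w \<cdot> (\<Lambda> (val C e \<oplus> w) \<cdot> \<alpha> \<zero> (val C e) w)"
    using lam_nat[of "normal e w"] special_lam by simp
  finally show ?case
    using special_lam by (simp only: lam_osum val_in)
next
  case (special_rho e)
  then show ?case
    by (simp add: triangle)
next
  case (special_eps e)
  let ?x = "val C e"
  have "normal (Plus (Minus e) e) w = \<Lambda> w \<cdot> (\<epsilon> ?x \<boxplus> \<one> w) \<cdot> inv (\<alpha> (\<ominus> ?x) ?x w)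
      \<cdot> ((\<one> (\<ominus> ?x) \<boxplus> inv (normal e w)) \<cdot> (\<one> (\<ominus> ?x) \<boxplus> normal e w)) \<cdot> \<alpha> (\<ominus> ?x) ?x w"
    using special_eps by (simp add: Let_def)
  then show ?case
    using special_eps by (simp add: interchange)
next
  case (special_del e)
  then show ?case
    using normal_del by simp
next
  case (special_cmp d e f e' g)
  from special_hom[OF special_cmp(1)] special_hom[OF special_cmp(2)]
  have *: "f \<in> Arr C" "g \<in> Arr C" "src C g = tgt C f" "gobjs e' \<subseteq> Obj C" "tgt C g = val C e'"
    by (auto simp: hom_iff)
  have "normal e' w \<cdot> (g \<cdot> f \<boxplus> \<one> w) = (normal e' w \<cdot> (g \<boxplus> \<one> w)) \<cdot> (f \<boxplus> \<one> w)"
    using * special_cmp.prems by (simp add: interchange)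
  then show ?case
    using special_cmp by simp
next
  case (special_asum d d' f e e' g)
  from special_hom[OF special_asum(1)] special_hom[OF special_asum(2)] show ?case
    by (intro normal_asum) (use special_asum in \<open>auto simp: hom_iff\<close>)
next
  case (special_inv d e f)
  from special_hom[OF special_inv(1)]
  have *: "f \<in> Arr C" "src C f = val C d" "tgt C f = val C e" "gobjs e \<subseteq> Obj C"
    by (auto simp: hom_iff)
  have "normal d w \<cdot> (inv f \<boxplus> \<one> w) = (normal e w \<cdot> (f \<boxplus> \<one> w)) \<cdot> (inv f \<boxplus> \<one> w)"
    using special_inv by simp
  also have "\<dots> = normal e w"
    using * special_inv.prems by (simp add: interchange)
  finally show ?case .
qed

section \<open>Coherence and the special isomorphisms in use\<close>

theorem special_unique:
  assumes "special C d e f" "special C d e g"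
  shows "f = g"
proof -
  from special_hom[OF assms(1)] special_hom[OF assms(2)]
  have *: "f \<in> Arr C" "g \<in> Arr C" "src C f = val C d" "tgt C f = val C e"
    "src C g = val C d" "tgt C g = val C e" "gobjs e \<subseteq> Obj C"
    by (auto simp: hom_iff)
  \<comment> \<open>Any representative would serve; that of \<open>\<zero>\<close> is at
    hand.\<close>
  let ?w = "rep \<zero>"
  have "normal e ?w \<cdot> (f \<boxplus> \<one> ?w) = normal e ?w \<cdot> (g \<boxplus> \<one> ?w)"
    using assms by (simp add: normal_special)
  then have "f \<boxplus> \<one> ?w = g \<boxplus> \<one> ?w"
    by (rule cmp_left_cancel) (use * in auto)
  then show ?thesis
    by (rule asum_idt_faithful) (use * in auto)
qed

text \<open>By coherence, any special isomorphism with the right formal ends evaluates the definite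
  description; the sum, the negative and the action are made explicit in this way.\<close>

lemma special_arrow_eqI: "special C d e f \<Longrightarrow> special_arrow C d e = f"
  unfolding special_arrow_def by (blast intro: special_unique)

lemma special_arrow_sum: "special_arrow C Zero (Plus Zero Zero) = inv (\<Lambda> \<zero>)"
  using special_inv[OF special_lam[of Zero C]] by (simp add: special_arrow_eqI)

lemma special_arrow_neg: "special_arrow C Zero (Minus Zero) = \<Lambda> (\<ominus> \<zero>) \<cdot> inv (\<delta> \<zero>)"
  using special_cmp[OF special_inv[OF special_del[of Zero C]] special_lam[of "Minus Zero" C]]
  by (simp add: special_arrow_eqI)

text \<open>\<open>inv (\<delta> r)\<close> creates \<open>r \<oplus> \<ominus> r\<close>, and the
  inverse of \<open>\<Lambda>\<close> then inserts \<open>\<zero>\<close> in the middle. This is how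
  \<open>\<delta>\<close> enters the action.\<close>

lemma special_arrow_act:
  assumes "r \<in> Obj C"
  shows "special_arrow C Zero (Plus (Gen r) (Plus Zero (Minus (Gen r))))
    = (\<one> r \<boxplus> inv (\<Lambda> (\<ominus> r))) \<cdot> inv (\<delta> r)"
  using special_cmp[OF special_inv[OF special_del[of "Gen r" C]]
      special_asum[OF special_idt[of "Gen r" C] special_inv[OF special_lam[of "Minus (Gen r)" C]]]] assms
  by (simp add: special_arrow_eqI)

section \<open>The c-crossed module of the star\<close>

lemma star_iff: "f \<in> star C \<longleftrightarrow> f \<in> Arr C \<and> src C f = \<zero>"
  by (simp add: star_def)

text \<open>In a groupoid any two arrows with the same source are isomorphic, so the congruence on the
  star is total and every law of the crossed module valued in it holds trivially.\<close>

lemma cong_star_cgroup: "cong (star_cgroup C) = star C \<times> star C"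
  by (auto simp: star_cgroup_def star_iff obj_iso_refl intro!: arr_isoI)

lemma elts_star_cgroup [simp]: "elts (star_cgroup C) = star C"
  by (simp add: star_cgroup_def)

lemma add_star_cgroup: "add (star_cgroup C) f g = (f \<boxplus> g) \<cdot> inv (\<Lambda> \<zero>)"
  by (simp add: star_cgroup_def special_arrow_sum)

lemma star_act_eq:
  "r \<in> Obj C \<Longrightarrow>
    star_act C r c = (\<one> r \<boxplus> (c \<boxplus> \<boxminus> \<one> r)) \<cdot> (\<one> r \<boxplus> inv (\<Lambda> (\<ominus> r))) \<cdot> inv (\<delta> r)"
  by (simp add: star_act_def special_arrow_act)

text \<open>With a total congruence only closure of the operations is left, a matter of sources and
  targets.\<close>

lemma c_group_star: "c_group (star_cgroup C)"
proof
  show "equiv (elts (star_cgroup C)) (cong (star_cgroup C))"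
    by (auto simp: cong_star_cgroup equiv_def refl_on_def sym_def trans_def)
qed (auto simp: cong_star_cgroup, auto simp: star_cgroup_def star_iff special_arrow_sum special_arrow_neg)

text \<open>Each law is witnessed by the structural isomorphism of the same shape, inverted where
  the congruence is stated in the opposite direction.\<close>

lemma c_group_obj: "c_group (obj_cgroup C)"
proof
  show "equiv (elts (obj_cgroup C)) (cong (obj_cgroup C))"
    unfolding equiv_def refl_on_def sym_def trans_def
    by (simp add: obj_cgroup_def) (blast intro: obj_iso_refl obj_iso_sym obj_iso_trans)
next
  fix a a' b b'
  assume "(a, a') \<in> cong (obj_cgroup C)" "(b, b') \<in> cong (obj_cgroup C)"
  then obtain f g where "f \<in> Arr C" "src C f = a" "tgt C f = a'" "g \<in> Arr C" "src C g = b" "tgt C g = b'"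
    by (auto simp: obj_cgroup_def obj_iso_iff)
  then show "(add (obj_cgroup C) a b, add (obj_cgroup C) a' b') \<in> cong (obj_cgroup C)"
    using obj_isoI[of "f \<boxplus> g"] by (auto simp: obj_cgroup_def)
next
  fix a b c assume "a \<in> elts (obj_cgroup C)" "b \<in> elts (obj_cgroup C)" "c \<in> elts (obj_cgroup C)"
  then show "(add (obj_cgroup C) a (add (obj_cgroup C) b c), add (obj_cgroup C) (add (obj_cgroup C) a b) c)
      \<in> cong (obj_cgroup C)"
    using obj_isoI[of "inv (\<alpha> a b c)"] by (auto simp: obj_cgroup_def)
next
  fix a assume a: "a \<in> elts (obj_cgroup C)"
  show "(add (obj_cgroup C) a (zer (obj_cgroup C)), a) \<in> cong (obj_cgroup C)"
    using obj_isoI[of "\<rho> a"] a by (auto simp: obj_cgroup_def)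
  show "(a, add (obj_cgroup C) (zer (obj_cgroup C)) a) \<in> cong (obj_cgroup C)"
    using obj_isoI[of "inv (\<Lambda> a)"] a by (auto simp: obj_cgroup_def)
  show "(add (obj_cgroup C) a (neg (obj_cgroup C) a), zer (obj_cgroup C)) \<in> cong (obj_cgroup C)"
    using obj_isoI[of "\<delta> a"] a by (auto simp: obj_cgroup_def)
  show "(zer (obj_cgroup C), add (obj_cgroup C) (neg (obj_cgroup C) a) a) \<in> cong (obj_cgroup C)"
    using obj_isoI[of "inv (\<epsilon> a)"] a by (auto simp: obj_cgroup_def)
qed (auto simp: obj_cgroup_def)

lemma star_act_in: "\<lbrakk>r \<in> Obj C; c \<in> star C\<rbrakk> \<Longrightarrow> star_act C r c \<in> star C"
  by (simp add: star_act_eq star_iff)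

text \<open>Both arrows start at \<open>\<zero>\<close>, so \<open>g \<cdot> inv f\<close> connects
  their targets.\<close>

lemma obj_iso_tgt_star: "\<lbrakk>f \<in> star C; g \<in> star C\<rbrakk> \<Longrightarrow> obj_iso C (tgt C f) (tgt C g)"
  using obj_isoI[of "g \<cdot> inv f"] by (simp add: star_iff)

text \<open>The action laws and the Peiffer condition reduce to membership in the star. What remains
  is compatibility of the boundary with the congruences, from \<open>obj_iso_tgt_star\<close>, and
  strict equalities of objects, read off as targets.\<close>

lemma c_crossed_module_star: "c_crossed_module (star_ccmod C)"
proof -
  interpret M: c_group "star_cgroup C" by (rule c_group_star)
  interpret N: c_group "obj_cgroup C" by (rule c_group_obj)
  have obj [simp]: "elts (obj_cgroup C) = Obj C" "add (obj_cgroup C) = osum C" "neg (obj_cgroup C) = oneg C"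
    "zer (obj_cgroup C) = \<zero>"
    by (auto simp: obj_cgroup_def)
  have in_obj: "x \<in> Obj C \<and> y \<in> Obj C" if "(x, y) \<in> cong (obj_cgroup C)" for x y
    using that by (auto simp: obj_cgroup_def)
  have add: "add (star_cgroup C) f g \<in> star C" if "f \<in> star C" "g \<in> star C" for f g
    using M.add_closed that by simp
  have neg: "neg (star_cgroup C) f \<in> star C" if "f \<in> star C" for f
    using M.neg_in that by simp
  have "c_group_morphism (star_cgroup C) (obj_cgroup C) (restrict (tgt C) (star C))"
  proof
    fix a a' assume "(a, a') \<in> cong (star_cgroup C)"
    then have "a \<in> star C" "a' \<in> star C" "obj_iso C (tgt C a) (tgt C a')"
      by (auto simp: cong_star_cgroup obj_iso_tgt_star)
    then show "(restrict (tgt C) (star C) a, restrict (tgt C) (star C) a') \<in> cong (obj_cgroup C)"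
      by (auto simp: obj_cgroup_def star_iff)
  next
    fix a b assume "a \<in> elts (star_cgroup C)" "b \<in> elts (star_cgroup C)"
    then show "restrict (tgt C) (star C) (add (star_cgroup C) a b)
        = add (obj_cgroup C) (restrict (tgt C) (star C) a) (restrict (tgt C) (star C) b)"
      using add[of a b] by (simp add: add_star_cgroup star_iff)
  qed (auto simp: star_iff)
  moreover have "c_group_action (obj_cgroup C) (star_cgroup C) (star_act C)"
    by unfold_locales (auto simp: cong_star_cgroup star_act_in add dest: in_obj)
  moreover have "c_crossed_module_axioms (star_ccmod C)"
  proof
    fix b a assume "b \<in> elts (Ngrp (star_ccmod C))" "a \<in> elts (Mgrp (star_ccmod C))"
    then show "bnd (star_ccmod C) (act (star_ccmod C) b a)
      = add (Ngrp (star_ccmod C)) b (add (Ngrp (star_ccmod C)) (bnd (star_ccmod C) a) (neg (Ngrp (star_ccmod C)) b))"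
      using star_act_in[of b a] by (simp add: star_ccmod_def star_act_eq star_iff)
  next
    fix a a\<^sub>1 assume "a \<in> elts (Mgrp (star_ccmod C))" "a\<^sub>1 \<in> elts (Mgrp (star_ccmod C))"
    then show "(act (star_ccmod C) (bnd (star_ccmod C) a) a\<^sub>1,
        add (Mgrp (star_ccmod C)) a (add (Mgrp (star_ccmod C)) a\<^sub>1 (neg (Mgrp (star_ccmod C)) a)))
      \<in> cong (Mgrp (star_ccmod C))"
      by (auto simp: star_ccmod_def cong_star_cgroup add neg intro!: star_act_in) (simp add: star_iff)
  qed
  ultimately show ?thesis
    by (simp add: c_crossed_module_def star_ccmod_def)
qed

end

section \<open>The action of a morphism on the star\<close>

context categorical_group_morphism
begin

lemma map_Arr [simp]: "f \<in> Arr C \<Longrightarrow> T\<^sub>1 f \<in> Arr C'"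
  and src_map [simp]: "f \<in> Arr C \<Longrightarrow> src C' (T\<^sub>1 f) = T\<^sub>0 (src C f)"
  and tgt_map [simp]: "f \<in> Arr C \<Longrightarrow> tgt C' (T\<^sub>1 f) = T\<^sub>0 (tgt C f)"
  using hom_map[of f "src C f" "tgt C f"] by (auto simp: C.hom_iff C'.hom_iff)

lemma map_cmp' [simp]:
  "\<lbrakk>f \<in> Arr C; g \<in> Arr C; src C g = tgt C f\<rbrakk> \<Longrightarrow> T\<^sub>1 (cmp C g f) = cmp C' (T\<^sub>1 g) (T\<^sub>1 f)"
  by (rule map_cmp) (auto simp: C.hom_iff)

lemma map_inv [simp]: "f \<in> Arr C \<Longrightarrow> T\<^sub>1 (arr_inv C f) = arr_inv C' (T\<^sub>1 f)"
proof (rule sym, rule C'.arr_inv_eqI)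
  assume f: "f \<in> Arr C"
  then show "inverse_arrows C' (T\<^sub>1 f) (T\<^sub>1 (arr_inv C f))"
    using map_cmp'[of f "arr_inv C f"] map_cmp'[of "arr_inv C f" f]
    by (simp add: inverse_arrows_def C'.hom_iff map_idt del: map_cmp')
qed

declare obj_map [simp] map_idt [simp] map_osum [simp] map_asum [simp] map_null [simp]
  map_lam [simp] map_oneg [simp] map_aneg [simp]

lemma map_star [simp]: "f \<in> star C \<Longrightarrow> T\<^sub>1 f \<in> star C'"
  by (simp add: C.star_iff C'.star_iff)

text \<open>The only special isomorphism involved is the inverse of \<open>\<Lambda>\<close> at the
  null object, and morphisms preserve \<open>\<Lambda>\<close>.\<close>

lemma map_add_star:
  "\<lbrakk>f \<in> star C; g \<in> star C\<rbrakk>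
    \<Longrightarrow> T\<^sub>1 (add (star_cgroup C) f g) = add (star_cgroup C') (T\<^sub>1 f) (T\<^sub>1 g)"
  by (simp add: C.add_star_cgroup C'.add_star_cgroup C.star_iff)

text \<open>The explicit form of the action contains \<open>\<delta>\<close> at \<open>r\<close>,
  which a morphism need not preserve; hence the third assumption. All other ingredients are
  preserved by every morphism.\<close>

lemma map_star_act:
  assumes "r \<in> Obj C" "c \<in> star C" "T\<^sub>1 (del C r) = del C' (T\<^sub>0 r)"
  shows "T\<^sub>1 (star_act C r c) = star_act C' (T\<^sub>0 r) (T\<^sub>1 c)"
  using assms by (simp add: C.star_act_eq C'.star_act_eq C.star_iff)

lemma map_obj_iso:
  assumes "obj_iso C x y"
  shows "obj_iso C' (T\<^sub>0 x) (T\<^sub>0 y)"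
  using assms unfolding C.obj_iso_iff C'.obj_iso_iff by (metis map_Arr src_map tgt_map)

end

text \<open>Compatibility with the actions is a strict equality of arrows, and the actions are built
  with \<open>\<delta>\<close>; therefore preservation of \<open>\<delta>\<close> is assumed in
  addition to the morphism axioms.\<close>

theorem proposition3p1:
  fixes C :: "('o, 'a) catgrp" and C' :: "('p, 'b) catgrp"
    and F\<^sub>0 :: "'o \<Rightarrow> 'p" and F\<^sub>1 :: "'a \<Rightarrow> 'b"
  assumes "categorical_group C" and "categorical_group C'"
    and "categorical_group_morphism C C' F\<^sub>0 F\<^sub>1"
    and preserves_delta: "\<forall>x \<in> Obj C. F\<^sub>1 (del C x) = del C' (F\<^sub>0 x)"
  shows "c_crossed_module_morphism (star_ccmod C) (star_ccmod C') F\<^sub>0 (restrict F\<^sub>1 (star C))"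
proof -
  interpret categorical_group_morphism C C' F\<^sub>0 F\<^sub>1 by fact
  interpret X: c_crossed_module "star_ccmod C" by (rule C.c_crossed_module_star)
  interpret X': c_crossed_module "star_ccmod C'" by (rule C'.c_crossed_module_star)
  have X [simp]: "Mgrp (star_ccmod D) = star_cgroup D" "Ngrp (star_ccmod D) = obj_cgroup D"
    "bnd (star_ccmod D) = restrict (tgt D) (star D)" "act (star_ccmod D) = star_act D"
    "elts (obj_cgroup D) = Obj D" "add (obj_cgroup D) = osum D"
    for D :: "('x, 'y) catgrp"
    by (auto simp: star_ccmod_def obj_cgroup_def)
  \<comment> \<open>Closure under sums lets the restricted map be evaluated as
    \<open>F\<^sub>1\<close> on a sum.\<close>
  have add: "add (star_cgroup C) a b \<in> star C" if "a \<in> star C" "b \<in> star C" for a b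
    using X.G.add_closed[of a b] that by simp
  show ?thesis
  proof
    fix a a' assume "(a, a') \<in> cong (Ngrp (star_ccmod C))"
    then show "(F\<^sub>0 a, F\<^sub>0 a') \<in> cong (Ngrp (star_ccmod C'))"
      using map_obj_iso by (simp add: obj_cgroup_def)
  next
    fix a assume "a \<in> elts (Mgrp (star_ccmod C))"
    then show "F\<^sub>0 (bnd (star_ccmod C) a) = bnd (star_ccmod C') (restrict F\<^sub>1 (star C) a)"
      using map_star[of a] by (simp add: C.star_iff)
  next
    fix b a assume "b \<in> elts (Ngrp (star_ccmod C))" "a \<in> elts (Mgrp (star_ccmod C))"
    then show "restrict F\<^sub>1 (star C) (act (star_ccmod C) b a)
        = act (star_ccmod C') (F\<^sub>0 b) (restrict F\<^sub>1 (star C) a)"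
      \<comment> \<open>Equivariance is where \<open>preserves_delta\<close> enters.\<close>
      using preserves_delta by (simp add: C.star_act_in map_star_act)
  qed (auto simp: C.cong_star_cgroup C'.cong_star_cgroup add map_add_star)
qed

end
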